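(* For all $0<\lambda<\infty$ and $0<p<1$, $$\mathrm{E}[p\lambda]=p\sum_{k=0}^{\infty}(1-p)^k\,\mathrm{E}^{\ast(k+1)}[\lambda],$$ as an equality of probability measures.
   Context: For $\lambda>0$, $\mathrm{E}[\lambda]$ denotes the exponential distribution with parameter (rate) $\lambda$ on $[0,\infty)$, i.e. with density $\lambda \mathrm{e}^{-\lambda x}$, $x\geq 0$. For $k\in\mathbb{N}=\{1,2,\ldots\}$, $\mathrm{E}^{\ast k}[\lambda]$ denotes the $k$-fold convolution of $\mathrm{E}[\lambda]$ with itself (so $\mathrm{E}^{\ast 1}[\lambda]=\mathrm{E}[\lambda]$). *)

theory Defs
  imports "HOL-Probability.Probability"
begin

text \<open>
  Distributions on \<open>[0, \<infinity>)\<close> are regarded as Borel measures on the real line;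
  the library's \<^const>\<open>erlang_density\<close> vanishes on the negative half-line.
\<close>

definition exponential_measure :: "real \<Rightarrow> real measure" where
  "exponential_measure l = density lborel (exponential_density l)"

text \<open>The case \<open>k = 0\<close> is the usual convention, the unit mass at the origin.\<close>

fun convolution_power :: "'a::ordered_euclidean_space measure \<Rightarrow> nat \<Rightarrow> 'a measure" where
  "convolution_power M 0 = return borel 0"
| "convolution_power M (Suc 0) = M"
| "convolution_power M (Suc (Suc k)) = (convolution_power M (Suc k) \<star> M)"

text \<open>
  The setwise sum of a series of measures. It is meaningful if all of them live on the
  same measurable space, see \<open>emeasure_series_measure\<close>; that space is read off the first term.
\<close>

definition series_measure :: "(nat \<Rightarrow> 'a measure) \<Rightarrow> 'a measure" where
  "series_measure M = measure_of (space (M 0)) (sets (M 0)) (\<lambda>A. \<Sum>k. emeasure (M k) A)"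

lemma space_series_measure [simp]: "space (series_measure M) = space (M 0)"
  by (simp add: series_measure_def)

lemma sets_series_measure [simp, measurable_cong]: "sets (series_measure M) = sets (M 0)"
  by (simp add: series_measure_def)

lemma emeasure_series_measure:
  assumes sets_eq: "\<And>k. sets (M k) = sets (M 0)"
  shows "emeasure (series_measure M) A = (\<Sum>k. emeasure (M k) A)"
proof (cases "A \<in> sets (M 0)")
  case True
  have "countably_additive (sets (M 0)) (\<lambda>A. \<Sum>k. emeasure (M k) A)"
  proof (rule countably_additiveI)
    fix B :: "nat \<Rightarrow> 'a set"
    assume B: "range B \<subseteq> sets (M 0)" "disjoint_family B"
    have "(\<Sum>i. \<Sum>k. emeasure (M k) (B i)) =
        (\<integral>\<^sup>+i. (\<Sum>k. emeasure (M k) (B i)) \<partial>count_space UNIV)"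
      by (simp add: nn_integral_count_space_nat)
    also have "\<dots> = (\<Sum>k. \<integral>\<^sup>+i. emeasure (M k) (B i) \<partial>count_space UNIV)"
      by (rule nn_integral_suminf) simp
    also have "\<dots> = (\<Sum>k. \<Sum>i. emeasure (M k) (B i))"
      by (simp add: nn_integral_count_space_nat)
    also have "\<dots> = (\<Sum>k. emeasure (M k) (\<Union>i. B i))"
      using B sets_eq by (intro suminf_cong suminf_emeasure) auto
    finally show "(\<Sum>i. \<Sum>k. emeasure (M k) (B i)) = (\<Sum>k. emeasure (M k) (\<Union>i. B i))" .
  qed
  moreover have "positive (sets (M 0)) (\<lambda>A. \<Sum>k. emeasure (M k) A)"
    by (simp add: positive_def)
  ultimately show ?thesis
    using True unfolding series_measure_def
    by (simp add: emeasure_measure_of_sigma sets.sigma_algebra_axioms)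
next
  case False
  then have "A \<notin> sets (M k)" for k
    by (simp add: sets_eq [of k])
  with False show ?thesis
    by (simp add: emeasure_notin_sets)
qed

lemma sets_exponential_measure [simp, measurable_cong]:
  "sets (exponential_measure l) = sets borel"
  by (simp add: exponential_measure_def)

lemma prob_space_exponential_measure:
  "0 < l \<Longrightarrow> prob_space (exponential_measure l)"
  unfolding exponential_measure_def by (rule prob_space_exponential_density)

lemma sets_convolution_power [simp, measurable_cong]:
  assumes "sets M = sets borel"
  shows "sets (convolution_power M k) = sets borel"
  using assms by (cases "(M, k)" rule: convolution_power.cases) auto

end

theory Submission
  imports Defs
begin

text \<open>
  Both sides are absolutely continuous with respect to Lebesgue measure, so it suffices to
  compare densities. The \<open>(k + 1)\<close>-fold convolution of the exponential distribution of rate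
  \<open>l\<close> is the Erlang distribution with density \<open>l ^ (k + 1) * x ^ k * exp (- l * x) / k!\<close> on the
  positive half-line (\<open>convolution_power_exponential_measure\<close>). Weighting it by
  \<open>p * (1 - p) ^ k\<close> and summing over \<open>k\<close> produces the exponential series of \<open>(1 - p) * l * x\<close>,
  and \<open>p * l * exp (- l * x) * exp ((1 - p) * l * x) = p * l * exp (- p * l * x)\<close>
  (\<open>geometric_mixture_erlang_density\<close>). By monotone convergence, summing densities is the
  same as summing measures (\<open>series_measure_density\<close>).

  In probabilistic terms, a geometric number of independent waiting times of rate \<open>l\<close> adds up
  to the first point of a Poisson process of rate \<open>l\<close> thinned with retention probability \<open>p\<close>,
  which is a Poisson process of rate \<open>p * l\<close>.
\<close>

lemma scale_measure_density:
  assumes [measurable]: "f \<in> borel_measurable M"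
  shows "scale_measure c (density M f) = density M (\<lambda>x. c * f x)"
  by (intro measure_eqI) (auto simp: emeasure_density nn_integral_cmult mult.assoc)

text \<open>Monotone convergence lets the sum pass under the integral over each measurable set.\<close>

lemma series_measure_density:
  assumes f [measurable]: "\<And>k. f k \<in> borel_measurable M"
  shows "series_measure (\<lambda>k. density M (f k)) = density M (\<lambda>x. \<Sum>k. f k x)"
proof (rule measure_eqI)
  fix A assume "A \<in> sets (series_measure (\<lambda>k. density M (f k)))"
  then have A [measurable]: "A \<in> sets M"
    by simp
  have "emeasure (series_measure (\<lambda>k. density M (f k))) A
      = (\<Sum>k. \<integral>\<^sup>+x. f k x * indicator A x \<partial>M)"
    by (simp add: emeasure_series_measure emeasure_density)
  also have "\<dots> = (\<integral>\<^sup>+x. (\<Sum>k. f k x * indicator A x) \<partial>M)"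
    by (rule nn_integral_suminf [symmetric]) simp
  also have "\<dots> = emeasure (density M (\<lambda>x. \<Sum>k. f k x)) A"
    by (simp add: emeasure_density)
  finally show "emeasure (series_measure (\<lambda>k. density M (f k))) A
      = emeasure (density M (\<lambda>x. \<Sum>k. f k x)) A" .
qed simp

text \<open>
  Convolving measures convolves their densities, and convolving Erlang densities of equal rate
  adds their shapes. The library counts shapes from 0, so \<open>erlang_density k\<close> belongs to
  \<open>k + 1\<close> summands.
\<close>

lemma convolution_power_exponential_measure:
  assumes "0 < l"
  shows "convolution_power (exponential_measure l) (Suc k) = density lborel (erlang_density k l)"
proof (induction k)
  case 0
  show ?case
    by (simp add: exponential_measure_def)
next
  case (Suc k)
  have fin: "finite_measure (density lborel (erlang_density j l))" for j
    using prob_space_erlang_density [OF assms, of j] by (simp add: prob_space_def)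
  have "convolution_power (exponential_measure l) (Suc (Suc k))
      = (density lborel (erlang_density k l) \<star> density lborel (erlang_density 0 l))"
    using Suc by (simp add: exponential_measure_def)
  also have "\<dots> = density lborel
      (\<lambda>x. \<integral>\<^sup>+y. ennreal (erlang_density k l (x - y)) * ennreal (erlang_density 0 l y) \<partial>lborel)"
    by (rule convolution_density) (use fin in auto)
  also have "\<dots> = density lborel (erlang_density (Suc k) l)"
    by (subst convolution_erlang_density [OF assms]) simp
  finally show ?case .
qed

text \<open>
  On the positive half-line the factor \<open>p * l * exp (- l * x)\<close> is common to all terms, and the
  rest is the exponential series of \<open>(1 - p) * l * x\<close>.
\<close>

lemma geometric_mixture_erlang_density:
  "(\<lambda>k. p * ((1 - p) ^ k * erlang_density k l x)) sums exponential_density (p * l) x"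
proof (cases "x < 0")
  case True
  then show ?thesis
    by (simp add: erlang_density_def)
next
  case False
  have "(\<lambda>k. p * l * exp (- l * x) * (((1 - p) * l * x) ^ k /\<^sub>R fact k)) sums
      (p * l * exp (- l * x) * exp ((1 - p) * l * x))"
    by (intro sums_mult exp_converges)
  also have "p * l * exp (- l * x) * exp ((1 - p) * l * x) = exponential_density (p * l) x"
    using False by (simp add: exponential_density_def mult.assoc exp_add [symmetric])
      (simp add: algebra_simps)
  also have "(\<lambda>k. p * l * exp (- l * x) * (((1 - p) * l * x) ^ k /\<^sub>R fact k))
      = (\<lambda>k. p * ((1 - p) ^ k * erlang_density k l x))"
    using False by (simp add: erlang_density_def fun_eq_iff power_mult_distrib divide_inverse ac_simps)
  finally show ?thesis .
qed

theorem theorem2: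
  fixes l p :: real
  assumes "0 < l" and "0 < p" and "p < 1"
  shows "exponential_measure (p * l) =
    scale_measure (ennreal p)
      (series_measure (\<lambda>k. scale_measure (ennreal ((1 - p) ^ k))
        (convolution_power (exponential_measure l) (k + 1))))"
proof -
  have "scale_measure (ennreal p)
      (series_measure (\<lambda>k. scale_measure (ennreal ((1 - p) ^ k))
        (convolution_power (exponential_measure l) (k + 1))))
      = density lborel (\<lambda>x. ennreal p *
          (\<Sum>k. ennreal ((1 - p) ^ k) * ennreal (erlang_density k l x)))"
    using assms(1)
    by (simp add: convolution_power_exponential_measure scale_measure_density
        series_measure_density del: convolution_power.simps)
  also have "\<dots> = density lborel (\<lambda>x. \<Sum>k. ennreal (p * ((1 - p) ^ k * erlang_density k l x)))"
    using assms by (simp add: ennreal_mult flip: ennreal_suminf_cmult)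
  also have "\<dots> = density lborel (\<lambda>x. ennreal (exponential_density (p * l) x))"
    using assms
    by (simp only: suminf_ennreal_eq [OF _ geometric_mixture_erlang_density]
        mult_nonneg_nonneg zero_le_power erlang_density_nonneg less_imp_le diff_ge_0_iff_ge)
  finally show ?thesis
    by (simp add: exponential_measure_def)
qed

end
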